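(* There are only finitely many pairs of integers $(n,s)$ with $n\ge3$ and $0\le s\le n-1$ such that $(2+n)s(1-n+3s)\ge 0$ and $h_+(n,s)=0$ or $h_-(n,s)=0$, where for $\delta\in\{+1,-1\}$, \[ h_{\delta}(n,s) = n^3+(2-9s)n^2+(-7-9s+12s^2)n+6s^2+18s+4 + \delta\bigl(n^2-3(s-2)n-3s-7\bigr)\sqrt{(2+n)s(1-n+3s)}. \] *)

theory Defs
  imports Complex_Main
begin

text \<open>The sign parameter \<open>\<delta>\<close> is only meant to range over \<open>{1, -1}\<close>; \<open>h 1\<close> and \<open>h (-1)\<close> are
  \<open>h\<^sub>+\<close> and \<open>h\<^sub>-\<close>.  The formula is only meaningful where the radicand is nonnegative: the library's
  \<^term>\<open>sqrt\<close> is odd, hence negative (not undefined) on negative arguments.\<close>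

definition radicand :: "int \<Rightarrow> int \<Rightarrow> int" where
  "radicand n s = (2 + n) * s * (1 - n + 3 * s)"

definition h :: "int \<Rightarrow> int \<Rightarrow> int \<Rightarrow> real" where
  "h \<delta> n s =
     real_of_int (n^3 + (2 - 9 * s) * n^2 + (-7 - 9 * s + 12 * s^2) * n + 6 * s^2 + 18 * s + 4)
     + real_of_int \<delta> * real_of_int (n^2 - 3 * (s - 2) * n - 3 * s - 7)
         * sqrt (real_of_int (radicand n s))"

end

theory Submission
  imports Defs
begin

text \<open>Squaring \<open>h = 0\<close> gives \<open>(n - 1)\<^sup>2 (s + 1) G(n, s) = 0\<close> for a quartic \<open>G\<close>. With
  \<open>m = 3 n + 2\<close> and \<open>y = 3 s - n - 1\<close> the curve \<open>G = 0\<close> becomes \<open>m k = 20 (27 y\<^sup>2 - 128)\<close>, where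
  \<open>k = 4 m\<^sup>2 - 24 m - 27 y\<^sup>3 + 27 y\<^sup>2 - 384\<close>. Its only branch at infinity in the admissible region
  has \<open>27 y\<^sup>3 \<sim> 4 m\<^sup>2\<close>, so Runge's method applies: on that branch the integer
  \<open>k\<^sup>2 - 43200 (y + 1)\<close> is negative and tends to \<open>0\<close>, which is absurd far out.\<close>

definition quartic :: "int \<Rightarrow> int \<Rightarrow> int" where
  "quartic n s = n^4 - 9*s*n^3 + 6*n^3 + 27*s^2*n^2 - 30*s*n^2 + n^2 - 27*s^3*n + 54*s^2*n
     + 9*s*n - 24*n - 18*s^3 - 36*s^2 + 30*s + 16"

definition cofactor :: "int \<Rightarrow> int \<Rightarrow> int" where
  "cofactor m y = 4*m^2 - 24*m - 27*y^3 + 27*y^2 - 384"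

lemma h_eq_0_imp_square_eq:
  assumes "h \<delta> n s = 0" "\<delta>^2 = 1" "radicand n s \<ge> 0"
  shows "(n^3 + (2 - 9 * s) * n^2 + (-7 - 9 * s + 12 * s^2) * n + 6 * s^2 + 18 * s + 4)^2
    = (n^2 - 3 * (s - 2) * n - 3 * s - 7)^2 * radicand n s" (is "?A^2 = ?B^2 * _")
proof -
  have "real_of_int ?A = - (of_int \<delta> * of_int ?B * sqrt (of_int (radicand n s)))"
    using assms(1) unfolding h_def by linarith
  then have "(real_of_int ?A)^2 = of_int (\<delta>^2) * (of_int ?B)^2 * of_int (radicand n s)"
    using assms(3) by (simp add: power_mult_distrib)
  then have "real_of_int (?A^2) = of_int (?B^2 * radicand n s)"
    using assms(2) by simp
  then show ?thesis
    by (simp only: of_int_eq_iff)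
qed

lemma square_difference_factorization:
  "(n^3 + (2 - 9 * s) * n^2 + (-7 - 9 * s + 12 * s^2) * n + 6 * s^2 + 18 * s + 4)^2
    - (n^2 - 3 * (s - 2) * n - 3 * s - 7)^2 * radicand n s
    = (n - 1)^2 * (s + 1) * quartic n s"
  unfolding radicand_def quartic_def by algebra

lemma quartic_eq_0_of_h_eq_0:
  assumes "h \<delta> n s = 0" "\<delta>^2 = 1" "radicand n s \<ge> 0" "n \<noteq> 1" "s \<noteq> -1"
  shows "quartic n s = 0"
proof -
  have "(n - 1)^2 * (s + 1) * quartic n s = 0"
    using h_eq_0_imp_square_eq[OF assms(1-3)] square_difference_factorization[of n s] by simp
  then show ?thesis
    using assms(4,5) by auto
qed

text \<open>The quartic has top-degree form n (n - 3 s)^3 and s^3-coefficient -9 (3 n + 2), so m and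
  y are adapted to its two directions at infinity. In these coordinates m divides a polynomial in y
  alone.\<close>

lemma quartic_eq_0_imp_cofactor_eq:
  assumes "quartic n s = 0" "m = 3*n + 2" "y = 3*s - n - 1"
  shows "m * cofactor m y = 20 * (27*y^2 - 128)"
proof -
  have "m * cofactor m y - 20 * (27*y^2 - 128) = 81 * quartic n s"
    unfolding assms(2,3) quartic_def cofactor_def by algebra
  then show ?thesis
    using assms(1) by simp
qed

text \<open>With 27 y^3 ~ 4 m^2 and m k ~ 540 y^2 one gets k^2 ~ 43200 y. Subtracting 43200 (y + 1)
  cancels enough that the right side is o(m^2) on this branch.\<close>

lemma cofactor_square_expansion:
  assumes "m * k = 20 * (27*y^2 - 128)" "k = cofactor m y"
  shows "m^2 * (k^2 - 43200*(y + 1))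
    = - (259200*m*(y + 1) + 10800*k*(y + 1) + 400*(6183*y^2 + 10368*y - 6016))"
  using assms unfolding cofactor_def by algebra

lemma cofactor_eq_imp_less:
  fixes m y :: int
  assumes "m * cofactor m y = 20 * (27*y^2 - 128)" "m > 0"
  shows "y < 10^12"
proof (rule ccontr)
  assume "\<not> y < 10^12"
  then have y: "y \<ge> 10^12" by simp
  define k where "k = cofactor m y"
  have mk: "m * k = 20 * (27*y^2 - 128)"
    using assms(1) by (simp add: k_def)
  have y2: "y^2 \<ge> 10^12 * y"
    using y by (simp add: power2_eq_square)
  have "m * k > 0"
    using mk y2 y by simp
  then have k: "k > 0"
    using assms(2) by (simp add: zero_less_mult_iff)
  have "y^3 \<ge> 10^12 * y^2"
    using y mult_right_mono[of "10^12" y "y^2"] by (simp add: power3_eq_cube power2_eq_square)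
  then have y3: "y^3 \<le> m^2"
    using k assms(2) y2 y unfolding k_def cofactor_def by simp
  \<comment> \<open>The threshold 10^12 for y is chosen so that this factor 10^6 outweighs the
    coefficient 259200 in the expansion.\<close>
  have my: "m \<ge> 10^6 * y"
  proof (rule ccontr)
    assume "\<not> ?thesis"
    then have "m^2 < (10^6 * y)^2"
      using assms(2) by (intro power_strict_mono) auto
    then have "y^3 < 10^12 * y^2"
      using y3 by (simp add: power_mult_distrib)
    with \<open>y^3 \<ge> 10^12 * y^2\<close> show False by simp
  qed
  have "y \<ge> 1"
    using y by simp
  have m: "m \<ge> 10^18"
    using my y by simp
  have m2: "m^2 \<ge> 10^18 * m" "m^2 \<ge> 10^6 * (m * y)" "m^2 \<ge> 10^12 * y^2"
    using m mult_left_mono[OF my, of m] power_mono[OF my, of 2] assms(2) y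
    by (auto simp: power2_eq_square algebra_simps)
  have "m * (k * y) = 540 * y^3 - 2560 * y"
    using mk by algebra
  also have "\<dots> \<le> m * (540 * m)"
    using y3 y by (simp add: power2_eq_square)
  finally have ky: "k * y \<le> 540 * m"
    using assms(2) by simp
  have k_le: "k \<le> k * y"
    using k y by simp
  have m_le: "m \<le> m * y"
    using assms(2) y by simp
  have expansion: "m^2 * (k^2 - 43200*(y + 1))
    = - (259200*(m*y) + 259200*m + 10800*(k*y) + 10800*k + 2473200*y^2 + 4147200*y - 2406400)"
    using cofactor_square_expansion[OF mk k_def] by (simp add: algebra_simps)
  \<comment> \<open>In the bracket only the constant is negative, and 4147200 y exceeds it.\<close>
  have "m^2 * (k^2 - 43200*(y + 1)) < m^2 * 0"
    unfolding expansion using k k_le m_le assms(2) \<open>y \<ge> 1\<close> zero_le_power2[of y] by linarith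
  then have neg: "k^2 - 43200*(y + 1) < 0"
    using assms(2) by (simp add: mult_less_0_iff)
  \<comment> \<open>The two leading terms cost at most 0.26 m^2 each; the others are negligible. An
    integer strictly between -1 and 0 results.\<close>
  have "m^2 * (k^2 - 43200*(y + 1)) > m^2 * (-1)"
    unfolding expansion using k_le m_le ky m2 y y2 m by simp
  then have "k^2 - 43200*(y + 1) > -1"
    using assms(2) by (simp only: mult_less_cancel_left_pos zero_less_power)
  with neg show False by simp
qed

text \<open>With y bounded on both sides, 4 m^2 dominates \<open>cofactor m y\<close> for large m.
  The cofactor is then at least 1, so m is at most 20 (27 y^2 - 128).\<close>

lemma cofactor_eq_imp_bounded:
  fixes m y :: int
  assumes "m * cofactor m y = 20 * (27*y^2 - 128)" "m > 0" "y \<ge> -2"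
  shows "m < 10^40"
proof (rule ccontr)
  assume "\<not> m < 10^40"
  then have m: "m \<ge> 10^40" by simp
  have y: "\<bar>y\<bar> \<le> 10^12"
    using cofactor_eq_imp_less[OF assms(1,2)] assms(3) by simp
  have y2: "y^2 \<le> 10^24"
    using power_mono[OF y, of 2] by simp
  have "\<bar>y\<bar>^3 \<le> 10^36"
    using power_mono[OF y, of 3] by simp
  then have y3: "y^3 \<le> 10^36"
    by (metis abs_ge_self order_trans power_abs)
  have "m^2 \<ge> 10^40 * m"
    using m by (simp add: power2_eq_square)
  then have "m^2 \<ge> 24 * m + 27 * 10^36 + 385"
    using m by simp
  then have "1 \<le> cofactor m y"
    using y3 zero_le_power2[of y] zero_le_power2[of m] unfolding cofactor_def by linarith
  then have "m * 1 \<le> m * cofactor m y"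
    using assms(2) by (intro mult_left_mono) auto
  with assms(1) y2 m show False by simp
qed

theorem theorem4p4:
  shows "finite {(n :: int, s :: int). 3 \<le> n \<and> 0 \<le> s \<and> s \<le> n - 1
           \<and> radicand n s \<ge> 0 \<and> (h 1 n s = 0 \<or> h (-1) n s = 0)}"
proof -
  have bound: "n \<le> 10^40"
    if n: "3 \<le> n" and s: "0 \<le> s" "s < n" and rad: "radicand n s \<ge> 0"
      and h: "h 1 n s = 0 \<or> h (-1) n s = 0" for n s
  proof -
    have q: "quartic n s = 0"
      using h n s rad quartic_eq_0_of_h_eq_0[of 1 n s] quartic_eq_0_of_h_eq_0[of "-1" n s] by auto
    \<comment> \<open>For s = 0 the radicand vanishes and gives no sign for 1 - n + 3 s, so this
      case is excluded directly.\<close>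
    have "s \<noteq> 0"
    proof
      assume "s = 0"
      then have "quartic n s = ((n - 1) * (n + 4))^2"
        unfolding quartic_def by algebra
      then show False
        using q n by simp
    qed
    then have "(2 + n) * s > 0"
      using n s by simp
    \<comment> \<open>This is the lower bound y \<ge> -2.\<close>
    then have "1 - n + 3 * s \<ge> 0"
      using rad unfolding radicand_def by (simp add: zero_le_mult_iff)
    then have "3*n + 2 < 10^40"
      using n cofactor_eq_imp_bounded[OF quartic_eq_0_imp_cofactor_eq[OF q refl refl]] by simp
    then show ?thesis
      using n by simp
  qed
  show ?thesis
    by (rule finite_subset[of _ "{3..10^40} \<times> {0..10^40}"]) (use bound in force)+
qed

end
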